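(* Let $U$ be a set, $d>0$ an integer, $0\leq c_1\leq\cdots\leq c_{d-1}$ integers, and let $(\mathbf{B},\mathbf{G})$ be a $(c_1,\ldots,c_{d-1})$-forbidding system on $U$. Let $S_1,\ldots,S_m\subseteq U$ be finite $(\mathbf{B},\mathbf{G})$-compatible sets such that $S_1^{(d)},\ldots,S_m^{(d)}$ are mutually disjoint. Let $\mathcal F=\bigcup_{i=1}^m S_i^{(d)}$, and let $\partial\mathcal F$ be the family of all $(d-1)$-tuples obtained from tuples in $\mathcal F$ by removing the last entry. If $t\geq c_{d-1}$ is a real number with $|\mathcal F|=t(t-c_1)\cdots(t-c_{d-1})$, then \[|\partial\mathcal F|\geq t(t-c_1)\cdots(t-c_{d-2}).\]
   Context: All set operations here are for multisets. For a set $U$ and $k\geq 1$, let $M_k$ be the family of all multisets of size $k$ with elements from $U$. Let $\mathbf{B}=(B_1,\ldots,B_d)$ and $\mathbf{G}=(G_1,\ldots,G_d)$ be sequences of families of multisets with $B_1=\emptyset$ and $B_k\sqcup G_k=M_k$ for all $k$. For $A\in M_k$ and $x\in U$, the multiset $A\cup\{x\}$ is an extension of $A$; it is a bad extension if $A\cup\{x\}\in B_{k+1}$ and a good extension if $A\cup\{x\}\in G_{k+1}$. The pair $(\mathbf{B},\mathbf{G})$ is a $(c_1,\ldots,c_{d-1})$-forbidding system if for every $0<k<d$ and every $A\in M_k$: if $A\in B_k$ then all extensions of $A$ are bad, and if $A\in G_k$ then there are exactly $c_k$ elements $x\in U$ for which $A\cup\{x\}$ is a bad extension. A subset $S\subseteq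 U$ is $(\mathbf{B},\mathbf{G})$-compatible if for all $0<k<d$ and all $A\in G_k$ consisting of elements of $S$, every $x\in U$ with $A\cup\{x\}\in B_{k+1}$ lies in $S$. For such $S$, $S^{(d)}=\{(x_1,\ldots,x_d)\in S^d : \{x_1,\ldots,x_d\}\in G_d\}$.
   Formalization: The formal theorem additionally assumes that the family F is non-empty; for empty F the claim fails, e.g. d=2, c_1=1, B_2 the multisets {x,x}, S_1 a single point, t=1, where |F|=0=t(t-1) but the shadow is empty and the bound is 1. *)

theory Defs
  imports Complex_Main "HOL-Library.Multiset" "HOL-Library.Disjoint_Sets"
begin

definition msets_of_size :: "'a set \<Rightarrow> nat \<Rightarrow> 'a multiset set" where
  "msets_of_size U k = {A. set_mset A \<subseteq> U \<and> size A = k}"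

text \<open>
  The sequences \<open>(B\<^sub>1, \<dots>, B\<^sub>d)\<close> and \<open>(G\<^sub>1, \<dots>, G\<^sub>d)\<close> are functions on \<^typ>\<open>nat\<close> of which only
  the values at \<open>1, \<dots>, d\<close> matter. The multiset union \<open>A \<union> {x}\<close> adds multiplicities, so it is
  \<^term>\<open>add_mset x A\<close>, and for \<open>A\<close> of size \<open>k\<close> it is tested against \<open>B\<^sub>k\<^sub>+\<^sub>1\<close>.
\<close>

definition bad_extensions :: "'a set \<Rightarrow> (nat \<Rightarrow> 'a multiset set) \<Rightarrow> 'a multiset \<Rightarrow> 'a set" where
  "bad_extensions U B A = {x \<in> U. add_mset x A \<in> B (size A + 1)}"

text \<open>
  Finiteness of the set of bad extensions is required separately, because \<^const>\<open>card\<close> is \<open>0\<close> on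
  infinite sets and \<open>c k = 0\<close> is allowed.
\<close>

definition forbidding_system ::
  "'a set \<Rightarrow> nat \<Rightarrow> (nat \<Rightarrow> nat) \<Rightarrow> (nat \<Rightarrow> 'a multiset set) \<Rightarrow> (nat \<Rightarrow> 'a multiset set) \<Rightarrow> bool" where
  "forbidding_system U d c B G \<longleftrightarrow>
     B 1 = {} \<and>
     (\<forall>k. 1 \<le> k \<and> k \<le> d \<longrightarrow> B k \<union> G k = msets_of_size U k \<and> B k \<inter> G k = {}) \<and>
     (\<forall>k. 0 < k \<and> k < d \<longrightarrow> (\<forall>A \<in> msets_of_size U k.
        (A \<in> B k \<longrightarrow> bad_extensions U B A = U) \<and>
        (A \<in> G k \<longrightarrow> finite (bad_extensions U B A) \<and> card (bad_extensions U B A) = c k)))"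

definition compatible ::
  "'a set \<Rightarrow> nat \<Rightarrow> (nat \<Rightarrow> 'a multiset set) \<Rightarrow> (nat \<Rightarrow> 'a multiset set) \<Rightarrow> 'a set \<Rightarrow> bool" where
  "compatible U d B G S \<longleftrightarrow>
     S \<subseteq> U \<and>
     (\<forall>k. 0 < k \<and> k < d \<longrightarrow> (\<forall>A \<in> G k. set_mset A \<subseteq> S \<longrightarrow> bad_extensions U B A \<subseteq> S))"

text \<open>The set \<open>S\<^sup>(\<^sup>d\<^sup>)\<close>; a \<open>d\<close>-tuple is a list of length \<open>d\<close>.\<close>

definition good_tuples :: "nat \<Rightarrow> (nat \<Rightarrow> 'a multiset set) \<Rightarrow> 'a set \<Rightarrow> 'a list set" where
  "good_tuples d G S = {xs. length xs = d \<and> set xs \<subseteq> S \<and> mset xs \<in> G d}"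

definition shadow :: "'a list set \<Rightarrow> 'a list set" where
  "shadow F = butlast ` F"

text \<open>
  The product \<open>t (t - c\<^sub>1) \<cdots> (t - c\<^sub>n\<^sub>-\<^sub>1)\<close> of \<open>n\<close> factors, the empty product \<open>1\<close> for \<open>n = 0\<close>.
\<close>

definition shifted_prod :: "(nat \<Rightarrow> nat) \<Rightarrow> nat \<Rightarrow> real \<Rightarrow> real" where
  "shifted_prod c n t = (\<Prod>k<n. if k = 0 then t else t - real (c k))"

end

theory Submission
  imports Defs
begin

text \<open>
  For a good multiset \<open>A\<close> of size \<open>k\<close> let \<open>N n A\<close> be the number of \<open>n\<close>-tuples which complete \<open>A\<close> to
  a good multiset inside some \<open>S\<^sub>i\<close>. The bound is proved, by induction on \<open>n\<close>, in the relative form: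
  if \<open>k + n = d\<close> and \<open>N n A = (t - c\<^sub>k) \<cdots> (t - c\<^sub>d\<^sub>-\<^sub>1)\<close>, then
  \<open>N (n - 1) A \<ge> (t - c\<^sub>k) \<cdots> (t - c\<^sub>d\<^sub>-\<^sub>2)\<close>. As in Keevash's proof of the Kruskal-Katona theorem, it
  suffices that \<open>N (n - 1) (A + v) \<le> (t - c\<^sub>d\<^sub>-\<^sub>1) N (n - 2) (A + v)\<close> for every \<open>v\<close>, because the sums
  of the two counts over \<open>v\<close> are \<open>N n A\<close> and \<open>N (n - 1) A\<close>. Write \<open>N (n - 1) (A + v)\<close> as the
  product for a parameter \<open>s\<close>. If \<open>s \<le> t\<close>, the induction hypothesis gives the inequality. If \<open>s > t\<close>
  and the bound for \<open>A\<close> fails, it follows because exactly \<open>(c\<^sub>d\<^sub>-\<^sub>1 - c\<^sub>k) N (n - 2) (A + v)\<close> of the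
  \<open>(n - 1)\<close>-tuples completing \<open>A\<close> become bad when \<open>v\<close> is added. This count rests on an exchange
  property: if \<open>A + v\<close> and \<open>A + y\<close> are good but \<open>A + v + y\<close> is bad, then \<open>A + v\<close> and \<open>A + y\<close> have
  equally many completions.
\<close>

section \<open>Forbidding systems, compatible sets and completions\<close>

lemma card_eq_sum_Cons:
  assumes "finite L" "finite V" "\<And>xs. xs \<in> L \<Longrightarrow> xs \<noteq> [] \<and> hd xs \<in> V"
  shows "card L = (\<Sum>y\<in>V. card {ys. y # ys \<in> L})"
proof -
  have "L = (\<Union>y\<in>V. (#) y ` {ys. y # ys \<in> L})"
  proof (intro equalityI subsetI)
    fix xs assume "xs \<in> L"
    with assms(3)[OF this] show "xs \<in> (\<Union>y\<in>V. (#) y ` {ys. y # ys \<in> L})"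
      by (cases xs) auto
  qed auto
  moreover have "finite ((#) y ` {ys. y # ys \<in> L})" for y
    by (rule finite_subset[OF _ assms(1)]) auto
  ultimately have "card L = (\<Sum>y\<in>V. card ((#) y ` {ys. y # ys \<in> L}))"
    using card_UN_disjoint[of V "\<lambda>y. (#) y ` {ys. y # ys \<in> L}"] assms(2) by auto
  then show ?thesis
    by (simp add: card_image)
qed

text \<open>One predicate \<open>good\<close> on multisets replaces both sequences, the level being
  read off from the size. Sizes start at 0, so that the empty multiset can serve as the root of the
  recursion.\<close>

locale forbidding =
  fixes U :: "'a set" and d :: nat and c :: "nat \<Rightarrow> nat" and good :: "'a multiset \<Rightarrow> bool"
  assumes good_add_mset: "good (add_mset x A) \<Longrightarrow> size A < d \<Longrightarrow> good A"
    and good_subset: "good A \<Longrightarrow> size A \<le> d \<Longrightarrow> set_mset A \<subseteq> U"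
    and finite_bad: "good A \<Longrightarrow> size A < d \<Longrightarrow> finite {x \<in> U. \<not> good (add_mset x A)}"
    and card_bad: "good A \<Longrightarrow> size A < d \<Longrightarrow> card {x \<in> U. \<not> good (add_mset x A)} = c (size A)"
    and c_mono: "k \<le> l \<Longrightarrow> l < d \<Longrightarrow> c k \<le> c l"
begin

definition bad :: "'a multiset \<Rightarrow> 'a set" where
  "bad A = {x \<in> U. \<not> good (add_mset x A)}"

definition compat :: "'a set \<Rightarrow> bool" where
  "compat T \<longleftrightarrow> finite T \<and> T \<subseteq> U \<and>
     (\<forall>A. good A \<longrightarrow> size A < d \<longrightarrow> set_mset A \<subseteq> T \<longrightarrow> bad A \<subseteq> T)"

text \<open>Requiring \<open>A\<close> itself to lie in \<open>T\<close> lets the first entry of a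
  tuple be moved into the multiset without changing the condition.\<close>

definition completions :: "'a set \<Rightarrow> nat \<Rightarrow> 'a multiset \<Rightarrow> 'a list set" where
  "completions T n A =
     {ys. length ys = n \<and> good (A + mset ys) \<and> set_mset A \<union> set ys \<subseteq> T}"

definition fcompletions :: "'a set set \<Rightarrow> nat \<Rightarrow> 'a multiset \<Rightarrow> 'a list set" where
  "fcompletions \<S> n A = (\<Union>T\<in>\<S>. completions T n A)"

lemma good_union: "good (A + C) \<Longrightarrow> size (A + C) \<le> d \<Longrightarrow> good A"
proof (induction C)
  case (add x C)
  then show ?case using good_add_mset[of x "A + C"] by simp
qed simp

lemma compatD:
  "compat T \<Longrightarrow> good A \<Longrightarrow> size A < d \<Longrightarrow> set_mset A \<subseteq> T \<Longrightarrow> bad A \<subseteq> T"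
  unfolding compat_def by blast

lemma compat_Int: "compat T \<Longrightarrow> compat T' \<Longrightarrow> compat (T \<inter> T')"
  unfolding compat_def by (meson finite_Int le_infE le_infI inf.coboundedI1)

lemma finite_completions: "finite T \<Longrightarrow> finite (completions T n A)"
  by (rule finite_subset[OF _ finite_lists_length_eq[of T n]]) (auto simp: completions_def)

lemma completions_Cons:
  "{ys. y # ys \<in> completions T (Suc n) A} = completions T n (add_mset y A)"
  unfolding completions_def by auto

lemma fcompletions_Cons:
  "{ys. y # ys \<in> fcompletions \<S> (Suc n) A} = fcompletions \<S> n (add_mset y A)"
  unfolding fcompletions_def completions_def by auto

section \<open>Counting completions in compatible sets\<close>

lemma completions_Int:
  "completions (T \<inter> T') n A = completions T n A \<inter> completions T' n A"
  unfolding completions_def by auto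

lemma completions_empty:
  "\<not> good A \<Longrightarrow> size A + n \<le> d \<Longrightarrow> completions T n A = {}"
  unfolding completions_def using good_union by fastforce

lemma fcompletions_empty:
  "\<not> good A \<Longrightarrow> size A + n \<le> d \<Longrightarrow> fcompletions \<S> n A = {}"
  unfolding fcompletions_def by (simp add: completions_empty)

text \<open>The entries are chosen one at a time: all bad extensions of the current multiset lie in
  \<open>T\<close>, so the number of choices at each step depends only on \<open>card T\<close> and
  the size reached. Truncated subtraction is harmless, since a factor can be cut off only after an
  earlier factor is 0.\<close>

lemma card_completions:
  assumes "compat T" "good A" "set_mset A \<subseteq> T" "size A + n \<le> d"
  shows "card (completions T n A) = (\<Prod>l<n. card T - c (size A + l))"
  using assms(2-)
proof (induction n arbitrary: A)
  case 0
  then have "completions T 0 A = {[]}" by (auto simp: completions_def)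
  then show ?case by simp
next
  case (Suc n)
  have fin: "finite T" and sub: "T \<subseteq> U" using assms(1) by (auto simp: compat_def)
  have badT: "bad A \<subseteq> T" using compatD assms(1) Suc.prems by simp
  let ?p = "\<Prod>l<n. card T - c (Suc (size A) + l)"
  have "card (completions T (Suc n) A) =
      (\<Sum>y\<in>T. card {ys. y # ys \<in> completions T (Suc n) A})"
  proof (rule card_eq_sum_Cons)
    show "finite (completions T (Suc n) A)" "finite T" using finite_completions fin by auto
    show "xs \<noteq> [] \<and> hd xs \<in> T" if "xs \<in> completions T (Suc n) A" for xs
      using that by (cases xs) (auto simp: completions_def)
  qed
  also have "\<dots> = (\<Sum>y\<in>T. if y \<in> bad A then 0 else ?p)"
  proof (rule sum.cong)
    fix y assume y: "y \<in> T"
    show "card {ys. y # ys \<in> completions T (Suc n) A} = (if y \<in> bad A then 0 else ?p)"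
    proof (cases "y \<in> bad A")
      case True
      then show ?thesis unfolding completions_Cons
        using completions_empty[of "add_mset y A" n] Suc.prems by (simp add: bad_def)
    next
      case False
      then have "good (add_mset y A)" using y sub by (auto simp: bad_def)
      then show ?thesis unfolding completions_Cons
        using Suc.IH[of "add_mset y A"] Suc.prems y False by simp
    qed
  qed simp
  also have "\<dots> = card (T - bad A) * ?p"
    using fin by (simp add: sum.If_cases Diff_eq)
  also have "card (T - bad A) = card T - c (size A)"
    using card_Diff_subset[of "bad A" T] badT fin card_bad[of A] Suc.prems
    by (simp add: bad_def finite_subset)
  also have "(card T - c (size A)) * ?p = (\<Prod>l<Suc n. card T - c (size A + l))"
    by (simp add: prod.lessThan_Suc_shift del: prod.lessThan_Suc)
  finally show ?case .
qed

text \<open>By inclusion-exclusion, since compatible sets are closed under intersection.\<close>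

lemma card_UN_completions:
  assumes "finite I" "\<And>i. i \<in> I \<Longrightarrow> compat (S i) \<and> set_mset A \<union> set_mset A' \<subseteq> S i"
    and "good A" "good A'" "size A = size A'" "size A + n \<le> d"
  shows "card (\<Union>i\<in>I. completions (S i) n A) = card (\<Union>i\<in>I. completions (S i) n A')"
  using assms(1,2)
\<comment> \<open>\<open>S\<close> stays arbitrary because the hypothesis is also applied to the
  intersections \<open>S i \<inter> S a\<close>.\<close>
proof (induction I arbitrary: S)
  case empty
  then show ?case by simp
next
  case (insert a I)
  have fin: "finite (S i)" if "i \<in> insert a I" for i
    using insert.prems[OF that] by (simp add: compat_def)
  have split: "card (\<Union>i\<in>I. completions (S i) n X) + card (completions (S a) n X) =
      card (\<Union>i\<in>insert a I. completions (S i) n X) +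
      card (\<Union>i\<in>I. completions (S i \<inter> S a) n X)" for X
  proof -
    have "(\<Union>i\<in>I. completions (S i) n X) \<inter> completions (S a) n X =
        (\<Union>i\<in>I. completions (S i \<inter> S a) n X)"
      by (auto simp: completions_Int)
    moreover have "(\<Union>i\<in>I. completions (S i) n X) \<union> completions (S a) n X =
        (\<Union>i\<in>insert a I. completions (S i) n X)" by auto
    ultimately show ?thesis
      using card_Un_Int[of "\<Union>i\<in>I. completions (S i) n X" "completions (S a) n X"]
        insert.hyps(1) fin by (simp add: finite_completions)
  qed
  have "card (\<Union>i\<in>I. completions (S i) n A) = card (\<Union>i\<in>I. completions (S i) n A')"
    using insert.IH[of S] insert.prems by simp
  moreover have "card (\<Union>i\<in>I. completions (S i \<inter> S a) n A) =
      card (\<Union>i\<in>I. completions (S i \<inter> S a) n A')"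
    using insert.IH[of "\<lambda>i. S i \<inter> S a"] insert.prems compat_Int by simp
  moreover have "card (completions (S a) n A) = card (completions (S a) n A')"
    using card_completions[of "S a"] insert.prems[of a] assms(3-6) by simp
  ultimately show ?case using split[of A] split[of A'] by linarith
qed

section \<open>The shifted products as functions of the real parameter\<close>

definition P :: "nat \<Rightarrow> nat \<Rightarrow> real \<Rightarrow> real" where
  "P k n t = (\<Prod>l<n. t - real (c (k + l)))"

lemma P_Suc: "P k (Suc n) t = P k n t * (t - real (c (k + n)))"
  by (simp add: P_def)

lemma P_Suc_shift: "P k (Suc n) t = (t - real (c k)) * P (Suc k) n t"
  by (simp add: P_def prod.lessThan_Suc_shift del: prod.lessThan_Suc)

lemma P_mono:
  assumes "k + n \<le> d" "real (c (d - 1)) \<le> s" "s \<le> t"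
  shows "P k n s \<le> P k n t"
  unfolding P_def
proof (rule prod_mono)
  fix l assume "l \<in> {..<n}"
  then have "c (k + l) \<le> c (d - 1)" using assms(1) by (intro c_mono) auto
  then show "0 \<le> s - real (c (k + l)) \<and> s - real (c (k + l)) \<le> t - real (c (k + l))"
    using assms(2,3) by simp
qed

lemma P_nonneg:
  assumes "k + n \<le> d" "real (c (d - 1)) \<le> t"
  shows "0 \<le> P k n t"
  unfolding P_def
proof (rule prod_nonneg)
  fix l assume "l \<in> {..<n}"
  then have "c (k + l) \<le> c (d - 1)" using assms(1) by (intro c_mono) auto
  then show "0 \<le> t - real (c (k + l))" using assms(2) by simp
qed

text \<open>By the intermediate value theorem: the last factor vanishes at \<open>c (d - 1)\<close>,
  while at \<open>c (d - 1) + x + 1\<close> every factor is at least \<open>x + 1\<close>. This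
  supplies the parameter \<open>s\<close> of the induction.\<close>

lemma ex_P_eq:
  assumes "k + Suc n = d" "0 \<le> x"
  shows "\<exists>t \<ge> real (c (d - 1)). P k (Suc n) t = x"
proof -
  let ?a = "real (c (d - 1))"
  have d1: "d - 1 = k + n" using assms(1) by simp
  have "(x + 1) ^ Suc n = (\<Prod>l<Suc n. x + 1)" by simp
  also have "\<dots> \<le> P k (Suc n) (?a + x + 1)"
    unfolding P_def
  proof (rule prod_mono)
    fix l assume "l \<in> {..<Suc n}"
    then have "c (k + l) \<le> c (d - 1)" using assms(1) by (intro c_mono) auto
    then show "0 \<le> x + 1 \<and> x + 1 \<le> ?a + x + 1 - real (c (k + l))"
      using assms(2) by simp
  qed
  finally have "x \<le> P k (Suc n) (?a + x + 1)"
    using self_le_power[of "x + 1" "Suc n"] assms(2) by linarith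
  moreover have "P k (Suc n) ?a \<le> x" using assms(2) by (simp only: P_Suc d1) simp
  moreover have "continuous_on {?a..?a + x + 1} (P k (Suc n))"
    unfolding P_def by (intro continuous_intros)
  ultimately show ?thesis
    using IVT'[of "P k (Suc n)" ?a x "?a + x + 1"] assms(2) by auto
qed

end

section \<open>Completions within a family of compatible sets\<close>

locale forbidding_family = forbidding +
  fixes \<S> :: "'a set set"
  assumes finite_family: "finite \<S>"
    and compat_family: "T \<in> \<S> \<Longrightarrow> compat T"
begin

definition N :: "nat \<Rightarrow> 'a multiset \<Rightarrow> nat" where
  "N n A = card (fcompletions \<S> n A)"

text \<open>Only \<open>A\<close> and the tuple are required to lie in a common member of the
  family; \<open>v\<close> is not.\<close>

definition spoiled :: "'a \<Rightarrow> nat \<Rightarrow> 'a multiset \<Rightarrow> 'a list set" where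
  "spoiled v n A = {ys \<in> fcompletions \<S> n A. \<not> good (add_mset v (A + mset ys))}"

lemma finite_Union_family: "finite (\<Union>\<S>)"
  using finite_family compat_family by (auto simp: compat_def)

lemma Union_family_subset: "\<Union>\<S> \<subseteq> U"
  using compat_family by (auto simp: compat_def)

lemma finite_fcompletions: "finite (fcompletions \<S> n A)"
  unfolding fcompletions_def
  using finite_family compat_family by (auto intro: finite_completions simp: compat_def)

lemma hd_fcompletions:
  "xs \<in> fcompletions \<S> (Suc n) A \<Longrightarrow> xs \<noteq> [] \<and> hd xs \<in> \<Union>\<S>"
  by (cases xs) (auto simp: fcompletions_def completions_def)

lemma N_Suc: "N (Suc n) A = (\<Sum>y\<in>\<Union>\<S>. N n (add_mset y A))"
  unfolding N_def fcompletions_Cons[symmetric]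
  by (rule card_eq_sum_Cons) (use finite_fcompletions finite_Union_family hd_fcompletions in auto)

lemma N_bad: "\<not> good A \<Longrightarrow> size A + n \<le> d \<Longrightarrow> N n A = 0"
  unfolding N_def by (simp add: fcompletions_empty)

section \<open>Exchange, and the tuples spoiled by one more element\<close>

lemma card_spoiled_Suc:
  "card (spoiled v (Suc n) A) = (\<Sum>y\<in>\<Union>\<S>. card (spoiled v n (add_mset y A)))"
proof -
  have "{ys. y # ys \<in> spoiled v (Suc n) A} = spoiled v n (add_mset y A)" for y
    unfolding spoiled_def fcompletions_Cons[symmetric] by auto
  moreover have "card (spoiled v (Suc n) A) =
      (\<Sum>y\<in>\<Union>\<S>. card {ys. y # ys \<in> spoiled v (Suc n) A})"
  proof (rule card_eq_sum_Cons)
    show "finite (spoiled v (Suc n) A)" using finite_fcompletions by (simp add: spoiled_def)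
    show "xs \<noteq> [] \<and> hd xs \<in> \<Union>\<S>" if "xs \<in> spoiled v (Suc n) A" for xs
      using that hd_fcompletions unfolding spoiled_def by blast
  qed (rule finite_Union_family)
  ultimately show ?thesis by simp
qed

text \<open>
  A compatible set containing \<open>A\<close> contains \<open>v\<close> iff it contains \<open>y\<close>, as each of them is a bad
  extension of \<open>A\<close> with the other one adjoined.
\<close>

lemma N_exchange:
  assumes "good (add_mset v A)" "good (add_mset y A)" "\<not> good (add_mset y (add_mset v A))"
    and "size A + 1 + n \<le> d" "size A + 1 < d"
  shows "N n (add_mset v A) = N n (add_mset y A)"
proof -
  have vU: "v \<in> U" and yU: "y \<in> U"
    using good_subset[OF assms(1)] good_subset[OF assms(2)] assms(5) by auto
  have "y \<in> bad (add_mset v A)" "v \<in> bad (add_mset y A)"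
    using vU yU assms(3) by (simp_all add: bad_def add_mset_commute)
  then have iff: "set_mset (add_mset v A) \<subseteq> T \<longleftrightarrow> set_mset (add_mset y A) \<subseteq> T" if "T \<in> \<S>" for T
    using compatD[OF compat_family[OF that] assms(1)] compatD[OF compat_family[OF that] assms(2)]
      assms(5) by auto
  define I where "I = {T \<in> \<S>. set_mset (add_mset v A) \<subseteq> T}"
  have "fcompletions \<S> n (add_mset v A) = (\<Union>T\<in>I. completions T n (add_mset v A))"
    by (auto simp: fcompletions_def I_def completions_def)
  moreover have "fcompletions \<S> n (add_mset y A) = (\<Union>T\<in>I. completions T n (add_mset y A))"
    using iff by (auto simp: fcompletions_def I_def completions_def)
  moreover have "card (\<Union>T\<in>I. completions T n (add_mset v A)) =
      card (\<Union>T\<in>I. completions T n (add_mset y A))"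
  proof (rule card_UN_completions)
    show "finite I" using finite_family by (simp add: I_def)
    show "compat T \<and> set_mset (add_mset v A) \<union> set_mset (add_mset y A) \<subseteq> T" if "T \<in> I" for T
      using that iff[of T] compat_family[of T] by (auto simp: I_def)
  qed (use assms in auto)
  ultimately show ?thesis by (simp add: N_def)
qed

text \<open>Adding \<open>v\<close> creates \<open>c (Suc k) - c k\<close> new bad extensions, with
  \<open>k\<close> the size of \<open>A\<close>. If \<open>N n (add_mset v A)\<close> is nonzero,
  some member of the family contains \<open>A + v\<close>, and compatibility puts them all into the
  union of the family; otherwise both sides are 0.\<close>

lemma sum_bad:
  assumes "good (add_mset v A)" "size A + 1 < d"
  shows "(\<Sum>y\<in>\<Union>\<S>. if y \<in> bad (add_mset v A) - bad A then N n (add_mset v A) else 0) =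
    (c (Suc (size A)) - c (size A)) * N n (add_mset v A)"
proof (cases "N n (add_mset v A) = 0")
  case False
  then have "fcompletions \<S> n (add_mset v A) \<noteq> {}" by (auto simp: N_def)
  then obtain T where T: "T \<in> \<S>" "set_mset (add_mset v A) \<subseteq> T"
    by (auto simp: fcompletions_def completions_def)
  then have "bad (add_mset v A) \<subseteq> \<Union>\<S>"
    using compatD[OF compat_family[OF T(1)] assms(1)] assms(2) by auto
  then have sub: "bad (add_mset v A) - bad A \<subseteq> \<Union>\<S>" by blast
  have sum_if: "(\<Sum>y\<in>\<Union>\<S>. if y \<in> D then k else 0) = card D * k"
    if "D \<subseteq> \<Union>\<S>" for D and k :: nat
    using that finite_Union_family by (simp add: sum.If_cases Int_absorb1)
  have goodA: "good A" using good_add_mset assms by simp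
  have "bad A \<subseteq> bad (add_mset v A)"
    using good_add_mset[of v "add_mset _ A"] assms(2) by (auto simp: bad_def add_mset_commute)
  then have "card (bad (add_mset v A) - bad A) = c (Suc (size A)) - c (size A)"
    using card_Diff_subset[of "bad A" "bad (add_mset v A)"] finite_bad[OF goodA]
      card_bad[OF goodA] card_bad[OF assms(1)] assms(2) by (simp add: bad_def)
  then show ?thesis
    using sum_if[OF sub] by presburger
qed (auto intro!: sum.neutral)

text \<open>If \<open>y\<close> is already bad for \<open>A\<close>, there are no completions of
  \<open>A + y\<close>. Otherwise every completion of \<open>A + y\<close> is spoiled because
  \<open>A + v + y\<close> is bad, and \<open>N_exchange\<close> converts their number.\<close>

lemma card_spoiled_bad:
  assumes "good (add_mset v A)" "size A + 1 + n < d" "y \<in> bad (add_mset v A)"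
  shows "card (spoiled v n (add_mset y A)) = (if y \<in> bad A then 0 else N n (add_mset v A))"
proof (cases "y \<in> bad A")
  case True
  then show ?thesis
    using fcompletions_empty[of "add_mset y A" n] assms(2) by (simp add: bad_def spoiled_def)
next
  case False
  have ng: "\<not> good (add_mset y (add_mset v A))" and g: "good (add_mset y A)"
    using assms(3) False by (auto simp: bad_def)
  have "spoiled v n (add_mset y A) = fcompletions \<S> n (add_mset y A)"
  proof -
    have "\<not> good (add_mset v (add_mset y A + mset ys))" if "length ys = n" for ys
      using ng good_union[of "add_mset y (add_mset v A)" "mset ys"] that assms(2)
      by (auto simp: add_mset_commute)
    then show ?thesis by (auto simp: spoiled_def fcompletions_def completions_def)
  qed
  then show ?thesis
    using N_exchange[OF assms(1) g ng] assms False by (simp add: N_def)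
qed

text \<open>Split by the first entry \<open>y\<close>. A newly bad \<open>y\<close> spoils all its
  tuples, which \<open>sum_bad\<close> adds up; a \<open>y\<close> good for \<open>A + v\<close> is
  covered by the induction hypothesis for \<open>A + y\<close>. The two coefficients
  telescope.\<close>

lemma card_spoiled:
  assumes "good (add_mset v A)" "size A + Suc n = d - 1"
  shows "card (spoiled v (Suc n) A) = (c (d - 1) - c (size A)) * N n (add_mset v A)"
  using assms
proof (induction n arbitrary: A)
  case (0 A)
  have "card (spoiled v 0 (add_mset y A)) =
      (if y \<in> bad (add_mset v A) - bad A then N 0 (add_mset v A) else 0)"
    if y: "y \<in> \<Union>\<S>" for y
  proof (cases "y \<in> bad (add_mset v A)")
    case True
    then show ?thesis using card_spoiled_bad[OF 0(1) _ True, of 0] 0(2) by simp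
  next
    case False
    then have "good (add_mset v (add_mset y A))"
      using y Union_family_subset by (auto simp: bad_def add_mset_commute)
    then have "spoiled v 0 (add_mset y A) = {}"
      by (auto simp: spoiled_def fcompletions_def completions_def)
    then show ?thesis using False by simp
  qed
  then show ?case
    using sum_bad[OF 0(1), of 0] 0(2) by (simp add: card_spoiled_Suc)
next
  case (Suc n A)
  let ?A' = "add_mset v A" and ?k = "size A"
  let ?D = "bad ?A' - bad A" and ?c = "c (d - 1) - c (Suc ?k)"
  \<comment> \<open>One formula covers all \<open>y\<close>: the first summand vanishes unless
    \<open>y\<close> is newly bad, the second when \<open>A + v + y\<close> is bad.\<close>
  have "card (spoiled v (Suc n) (add_mset y A)) =
      (if y \<in> ?D then N (Suc n) ?A' else 0) + ?c * N n (add_mset y ?A')"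
    if y: "y \<in> \<Union>\<S>" for y
  proof (cases "y \<in> bad ?A'")
    case True
    then have "\<not> good (add_mset y ?A')" by (simp add: bad_def)
    then have "N n (add_mset y ?A') = 0" using N_bad[of "add_mset y ?A'" n] Suc.prems(2) by simp
    then show ?thesis
      using card_spoiled_bad[OF Suc.prems(1) _ True, of "Suc n"] True Suc.prems(2) by simp
  next
    case False
    then have g: "good (add_mset v (add_mset y A))"
      using y Union_family_subset by (auto simp: bad_def add_mset_commute)
    then show ?thesis
      using Suc.IH[OF g] Suc.prems(2) False by (simp add: add_mset_commute)
  qed
  then have "card (spoiled v (Suc (Suc n)) A) =
      (\<Sum>y\<in>\<Union>\<S>. if y \<in> ?D then N (Suc n) ?A' else 0) +
      ?c * (\<Sum>y\<in>\<Union>\<S>. N n (add_mset y ?A'))"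
    by (simp add: card_spoiled_Suc[of v "Suc n"] sum.distrib sum_distrib_left)
  also have "\<dots> = (c (Suc ?k) - c ?k) * N (Suc n) ?A' + ?c * N (Suc n) ?A'"
    using sum_bad[OF Suc.prems(1), of "Suc n"] Suc.prems(2) by (simp add: N_Suc)
  also have "\<dots> = (c (d - 1) - c ?k) * N (Suc n) ?A'"
    using c_mono[of ?k "Suc ?k"] c_mono[of "Suc ?k" "d - 1"] Suc.prems(2)
    by (simp flip: add_mult_distrib)
  finally show ?case .
qed

text \<open>A completion of \<open>A + v\<close> is a completion of \<open>A\<close> that
  \<open>v\<close> does not spoil, and \<open>card_spoiled\<close> counts the spoiled ones.\<close>

lemma N_add_mset_le:
  assumes "good (add_mset v A)" "size A + Suc n = d - 1"
  shows "N (Suc n) (add_mset v A) + (c (d - 1) - c (size A)) * N n (add_mset v A) \<le> N (Suc n) A"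
proof -
  have "fcompletions \<S> (Suc n) (add_mset v A) \<subseteq> fcompletions \<S> (Suc n) A - spoiled v (Suc n) A"
  proof
    fix ys assume ys: "ys \<in> fcompletions \<S> (Suc n) (add_mset v A)"
    then have g: "good (add_mset v (A + mset ys))" and len: "length ys = Suc n"
      by (auto simp: fcompletions_def completions_def)
    then have "good (A + mset ys)" using good_add_mset[OF g] assms(2) by simp
    with ys g show "ys \<in> fcompletions \<S> (Suc n) A - spoiled v (Suc n) A"
      by (auto simp: fcompletions_def completions_def spoiled_def)
  qed
  then have "N (Suc n) (add_mset v A) \<le> card (fcompletions \<S> (Suc n) A - spoiled v (Suc n) A)"
    unfolding N_def using finite_fcompletions by (intro card_mono) auto
  moreover have sub: "spoiled v (Suc n) A \<subseteq> fcompletions \<S> (Suc n) A"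
    by (auto simp: spoiled_def)
  then have "card (fcompletions \<S> (Suc n) A - spoiled v (Suc n) A) =
      N (Suc n) A - card (spoiled v (Suc n) A)"
    unfolding N_def using finite_fcompletions finite_subset by (intro card_Diff_subset) blast+
  ultimately have "N (Suc n) (add_mset v A) \<le> N (Suc n) A - card (spoiled v (Suc n) A)" by simp
  moreover have "card (spoiled v (Suc n) A) \<le> N (Suc n) A"
    unfolding N_def using sub finite_fcompletions by (intro card_mono) auto
  ultimately show ?thesis using card_spoiled[OF assms] by linarith
qed

section \<open>The relative bound, by induction on the number of remaining entries\<close>

lemma N_lower_bound:
  assumes "good A" "size A + Suc n = d" "real (c (d - 1)) \<le> t"
    and "real (N (Suc n) A) = P (size A) (Suc n) t" "0 < N (Suc n) A"
  shows "P (size A) n t \<le> real (N n A)"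
  using assms
proof (induction n arbitrary: A t)
  case (0 A t)
  from "0.prems"(5) have "fcompletions \<S> (Suc 0) A \<noteq> {}" by (auto simp: N_def)
  \<comment> \<open>Some member of the family contains \<open>A\<close>, so the empty tuple is a
    completion; the bound to be met is the empty product 1.\<close>
  then have "[] \<in> fcompletions \<S> 0 A"
    using "0.prems"(1) by (auto simp: fcompletions_def completions_def)
  then have "0 < N 0 A" unfolding N_def using finite_fcompletions card_gt_0_iff by blast
  then show ?case by (simp add: P_def)
next
  case (Suc n A t)
  let ?a = "real (c (d - 1))" and ?k = "size A"
  have d1: "d - 1 = ?k + Suc n" using Suc.prems(2) by simp
  \<comment> \<open>Positivity forces \<open>t\<close> strictly above \<open>c (d - 1)\<close>,
    which allows cancelling \<open>t - c (d - 1)\<close> at the end.\<close>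
  have N_pos: "0 < P ?k (Suc n) t * (t - ?a)"
    using Suc.prems(4,5) unfolding d1 P_Suc[of _ "Suc n"] by linarith
  then have t_gt: "?a < t"
    using Suc.prems(3) by (cases "t = ?a") auto
  show ?case
  proof (rule ccontr)
    assume "\<not> ?thesis"
    then have small: "real (N (Suc n) A) < (t - real (c ?k)) * P (Suc ?k) n t"
      by (simp add: P_Suc_shift)
    have link: "real (N (Suc n) (add_mset v A)) \<le> (t - ?a) * real (N n (add_mset v A))" for v
    proof (cases "N (Suc n) (add_mset v A) = 0")
      case True
      then show ?thesis using t_gt by simp
    next
      case False
      then have g: "good (add_mset v A)"
        using N_bad[of "add_mset v A" "Suc n"] Suc.prems(2) by auto
      obtain s where s: "?a \<le> s" "P (Suc ?k) (Suc n) s = real (N (Suc n) (add_mset v A))"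
        using ex_P_eq[of "Suc ?k" n "real (N (Suc n) (add_mset v A))"] Suc.prems(2) by auto
      have IH: "P (Suc ?k) n s \<le> real (N n (add_mset v A))"
        using Suc.IH[OF g _ s(1)] s(2) False Suc.prems(2) by simp
      show ?thesis
      proof (cases "s \<le> t")
        case True
        \<comment> \<open>The last factor of the product is at most \<open>t - c (d - 1)\<close>,
          and the induction hypothesis bounds the product of the others.\<close>
        have "real (N (Suc n) (add_mset v A)) = (s - ?a) * P (Suc ?k) n s"
          unfolding s(2)[symmetric] P_Suc d1 by simp
        also have "\<dots> \<le> (t - ?a) * real (N n (add_mset v A))"
          using True s(1) IH P_nonneg[of "Suc ?k" n s] Suc.prems(2) by (intro mult_mono) auto
        finally show ?thesis .
      next
        case False
        have "P (Suc ?k) n t \<le> P (Suc ?k) n s"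
          using P_mono[of "Suc ?k" n t s] False Suc.prems(2,3) by simp
        with IH have q: "P (Suc ?k) n t \<le> real (N n (add_mset v A))" by linarith
        have ck: "c ?k \<le> c (d - 1)" using c_mono d1 Suc.prems(2) by simp
        \<comment> \<open>With \<open>r = N n (A + v)\<close> and \<open>k\<close> the size of
          \<open>A\<close>, the assumed failure \<open>small\<close> gives
          \<open>N (Suc n) A < (t - c k) r\<close>; taking away the
          \<open>(c (d - 1) - c k) r\<close> spoiled tuples leaves less than
          \<open>(t - c (d - 1)) r\<close>.\<close>
        have "real (N (Suc n) (add_mset v A)) + (?a - real (c ?k)) * real (N n (add_mset v A))
            \<le> real (N (Suc n) A)"
          using N_add_mset_le[OF g, of n] d1 ck
          by (metis of_nat_add of_nat_diff of_nat_le_iff of_nat_mult)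
        moreover have "(t - real (c ?k)) * P (Suc ?k) n t
            \<le> (t - real (c ?k)) * real (N n (add_mset v A))"
          using q ck t_gt by (intro mult_left_mono) auto
        ultimately show ?thesis using small by (simp add: algebra_simps)
      qed
    qed
    \<comment> \<open>Summing \<open>link\<close> over \<open>v\<close> and cancelling
      \<open>t - c (d - 1)\<close> gives the bound that \<open>small\<close> denies.\<close>
    have "P ?k (Suc n) t * (t - ?a) = real (N (Suc (Suc n)) A)"
      using Suc.prems(4) unfolding d1 P_Suc[of _ "Suc n"] by simp
    also have "\<dots> \<le> (\<Sum>v\<in>\<Union>\<S>. (t - ?a) * real (N n (add_mset v A)))"
      unfolding N_Suc[of "Suc n"] of_nat_sum by (intro sum_mono link)
    also have "\<dots> = real (N (Suc n) A) * (t - ?a)"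
      unfolding N_Suc[of n] by (simp add: mult.commute flip: sum_distrib_left)
    finally show False
      using small t_gt by (simp add: P_Suc_shift[of _ n])
  qed
qed

end

section \<open>Application to the given sets and their shadow\<close>

theorem theorem4p4:
  fixes U :: "'a set" and d m :: nat and c :: "nat \<Rightarrow> nat"
    and B G :: "nat \<Rightarrow> 'a multiset set" and S :: "nat \<Rightarrow> 'a set"
    and F :: "'a list set" and t :: real
  assumes d_pos: "d > 0"
    and c_mono: "mono_on {1..d - 1} c"
    and system: "forbidding_system U d c B G"
    and S_finite: "\<And>i. i \<in> {1..m} \<Longrightarrow> finite (S i)"
    and S_compatible: "\<And>i. i \<in> {1..m} \<Longrightarrow> compatible U d B G (S i)"
    and S_disjoint: "disjoint_family_on (\<lambda>i. good_tuples d G (S i)) {1..m}"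
    and F_eq: "F = (\<Union>i\<in>{1..m}. good_tuples d G (S i))"
    and F_nonempty: "F \<noteq> {}"
    and t_ge: "d \<ge> 2 \<Longrightarrow> t \<ge> real (c (d - 1))"
    and F_card: "real (card F) = shifted_prod c d t"
  shows "real (card (shadow F)) \<ge> shifted_prod c (d - 1) t"
proof -
  \<comment> \<open>The empty multiset counts as good and has no bad extension, as
    \<open>B 1\<close> is empty. Putting \<open>c' 0 = 0\<close> then turns the leading factor
    \<open>t\<close> into \<open>t - c' 0\<close>, so that the relative bound can be applied at
    \<open>{#}\<close>.\<close>
  define good where "good A \<longleftrightarrow> A = {#} \<or> A \<in> G (size A)" for A
  define c' where "c' = c(0 := 0)"
  have B1: "B 1 = {}"
    and BG: "\<And>k. 1 \<le> k \<Longrightarrow> k \<le> d \<Longrightarrow> B k \<union> G k = msets_of_size U k \<and> B k \<inter> G k = {}"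
    using system unfolding forbidding_system_def by blast+
  have sys: "(A \<in> B (size A) \<longrightarrow> bad_extensions U B A = U) \<and>
      (A \<in> G (size A) \<longrightarrow>
        finite (bad_extensions U B A) \<and> card (bad_extensions U B A) = c (size A))"
    if "set_mset A \<subseteq> U" "0 < size A" "size A < d" for A
  proof -
    have "A \<in> msets_of_size U (size A)" using that(1) by (simp add: msets_of_size_def)
    then show ?thesis using system that(2,3) unfolding forbidding_system_def by blast
  qed
  have good_sub: "set_mset A \<subseteq> U" if "good A" "size A \<le> d" for A
  proof (cases "A = {#}")
    case False
    then have "A \<in> msets_of_size U (size A)"
      using that BG[of "size A"] by (auto simp: good_def Suc_le_eq nonempty_has_size)
    then show ?thesis by (simp add: msets_of_size_def)
  qed simp
  have not_good: "\<not> good A \<longleftrightarrow> A \<in> B (size A)"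
    if "set_mset A \<subseteq> U" "0 < size A" "size A \<le> d" for A
    using BG[of "size A"] that by (auto simp: good_def msets_of_size_def)
  have bad_eq: "{x \<in> U. \<not> good (add_mset x A)} = (if A = {#} then {} else bad_extensions U B A)"
    if "good A" "size A < d" for A
    using not_good[of "add_mset _ A"] good_sub[of A] that B1 by (auto simp: bad_extensions_def)
  interpret forbidding U d c' good
  proof
    fix x A assume g: "good (add_mset x A)" and sz: "size A < d"
    show "good A"
    proof (rule ccontr)
      assume ng: "\<not> good A"
      then have ne: "A \<noteq> {#}" by (auto simp: good_def)
      have sub: "set_mset (add_mset x A) \<subseteq> U" using good_sub[OF g] sz by simp
      have "A \<in> B (size A)" using not_good[of A] ng ne sub sz by (auto simp: nonempty_has_size)
      then have "add_mset x A \<in> B (size A + 1)"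
        using sys[of A] ne sz sub by (auto simp: nonempty_has_size bad_extensions_def)
      then show False using not_good[OF sub] g sz by simp
    qed
  next
    fix A assume g: "good A" and sz: "size A < d"
    then show "finite {x \<in> U. \<not> good (add_mset x A)}"
      "card {x \<in> U. \<not> good (add_mset x A)} = c' (size A)"
      unfolding bad_eq[OF g sz] using sys[of A] good_sub[OF g] g sz
      by (auto simp: c'_def nonempty_has_size good_def)
  next
    fix k l assume "k \<le> l" "l < d"
    then show "c' k \<le> c' l"
      using mono_onD[OF c_mono, of k l] by (cases "k = 0") (auto simp: c'_def)
  qed (rule good_sub)
  \<comment> \<open>Small sets carry no good \<open>d\<close>-tuples, but their \<open>(d - 1)\<close>-tuples need not lie in the shadow.\<close>
  define \<S> where "\<S> = {T \<in> S ` {1..m}. c' (d - 1) < card T}"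
  have compat_S: "compat (S i)" if i: "i \<in> {1..m}" for i
    unfolding compat_def
  proof (intro conjI allI impI)
    show "finite (S i)" "S i \<subseteq> U"
      using S_finite[OF i] S_compatible[OF i] by (auto simp: compatible_def)
    fix A assume A: "good A" "size A < d" "set_mset A \<subseteq> S i"
    show "bad A \<subseteq> S i"
    proof (cases "A = {#}")
      case False
      then have "bad_extensions U B A \<subseteq> S i"
        using A S_compatible[OF i] unfolding compatible_def good_def
        by (metis nonempty_has_size)
      then show ?thesis using bad_eq[OF A(1,2)] False by (simp add: bad_def)
    qed (use bad_eq[OF A(1,2)] in \<open>auto simp: bad_def\<close>)
  qed
  interpret forbidding_family U d c' good \<S>
    by unfold_locales (auto simp: \<S>_def compat_S)
  \<comment> \<open>More than \<open>c' (d - 1)\<close> elements leave room for a last entry, which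
    puts the \<open>(d - 1)\<close>-tuples of the restricted family into the shadow.\<close>
  have extendable: "\<exists>y\<in>T. good (add_mset y A)"
    if "compat T" "good A" "size A = d - 1" "set_mset A \<subseteq> T" "c' (d - 1) < card T" for A T
  proof -
    have "card (bad A) = c' (d - 1)" "finite (bad A)"
      using card_bad[OF that(2)] finite_bad[OF that(2)] that(3) d_pos by (simp_all add: bad_def)
    with that(5) have "\<not> T \<subseteq> bad A" by (metis card_mono leD)
    then show ?thesis using that(1) by (auto simp: bad_def compat_def)
  qed
  \<comment> \<open>Conversely, no tuple of \<open>F\<close> is lost in the restriction: removing
    one entry of a good \<open>d\<close>-tuple leaves a multiset whose bad extensions lie in
    \<open>S i\<close> and miss that entry.\<close>
  have large: "c' (d - 1) < card (S i)"
    if i: "i \<in> {1..m}" and xs: "xs \<in> good_tuples d G (S i)" for i xs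
  proof -
    obtain y A where A: "mset xs = add_mset y A"
      using xs d_pos by (cases xs) (auto simp: good_tuples_def)
    have sz: "size (mset xs) = d" using xs by (simp add: good_tuples_def)
    then have szA: "size A = d - 1" "size A < d" using A d_pos by auto
    have g: "good (add_mset y A)"
      using xs sz unfolding A[symmetric] by (simp add: good_def good_tuples_def)
    have gA: "good A" using good_add_mset[OF g] szA by simp
    have sub: "set_mset (mset xs) \<subseteq> S i" using xs by (simp add: good_tuples_def)
    then have "bad A \<subset> S i"
      using compatD[OF compat_S[OF i] gA szA(2)] g unfolding A by (auto simp: bad_def)
    then have "card (bad A) < card (S i)"
      using S_finite[OF i] by (intro psubset_card_mono) auto
    then show ?thesis using card_bad[OF gA szA(2)] szA by (simp add: bad_def)
  qed
  have tuples: "good_tuples d G T = completions T d {#}" for T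
    using d_pos by (auto simp: good_tuples_def completions_def good_def)
  have F: "F = fcompletions \<S> d {#}"
    using large unfolding F_eq fcompletions_def \<S>_def tuples by auto
  have prod: "shifted_prod c n t = P 0 n t" if "n \<le> d" for n
    unfolding shifted_prod_def P_def by (intro prod.cong) (auto simp: c'_def)
  \<comment> \<open>For \<open>d = 1\<close> the bound reads \<open>0 \<le> t\<close>, which holds
    because \<open>t\<close> is then \<open>card F\<close>.\<close>
  have t_ge': "real (c' (d - 1)) \<le> t"
  proof (cases "d = 1")
    case True
    then show ?thesis using F_card by (simp add: c'_def shifted_prod_def flip: F_card)
  next
    case False
    then show ?thesis using t_ge d_pos by (simp add: c'_def)
  qed
  have "P 0 (d - 1) t \<le> real (N (d - 1) {#})"
    using N_lower_bound[of "{#}" "d - 1" t] d_pos t_ge' F_card F_nonempty finite_fcompletions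
    by (simp add: prod N_def F good_def card_gt_0_iff)
  moreover have "fcompletions \<S> (d - 1) {#} \<subseteq> shadow F"
  proof
    fix xs assume "xs \<in> fcompletions \<S> (d - 1) {#}"
    then obtain T where T: "T \<in> \<S>" and xs: "length xs = d - 1" "good (mset xs)" "set xs \<subseteq> T"
      by (auto simp: fcompletions_def completions_def)
    then obtain y where y: "y \<in> T" "good (add_mset y (mset xs))"
      using extendable[OF compat_family[OF T], of "mset xs"] by (auto simp: \<S>_def)
    then have "xs @ [y] \<in> F"
      using T xs d_pos unfolding F by (auto simp: fcompletions_def completions_def)
    then show "xs \<in> shadow F" unfolding shadow_def by force
  qed
  then have "N (d - 1) {#} \<le> card (shadow F)"
    unfolding N_def using finite_fcompletions by (intro card_mono) (auto simp: shadow_def F)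
  ultimately show ?thesis by (simp add: prod)
qed

end
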